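(* For any natural numbers $k$ and $d$ there is a graph $G$ such that the interval spectrum $S(G)$ has exactly $k$ gaps, each of size at least $d$.
   Context: All graphs are finite. A graph $G=(V,E)$ is interval colorable if there is an edge-coloring $c\colon E\to\mathbb{Z}$ such that for every vertex $x$ the multiset $\{c(xy): xy\in E\}$ is a set of consecutive integers. For such $c$ let $c(G)=\{c(e):e\in E\}$. $G$ is $t$-interval colorable if it has an interval coloring $c$ with $|c(G)|=t$. The interval spectrum $S(G)$ is the set of all integers $t$ such that $G$ is $t$-interval colorable. A gap of a set of integers $S$ is a maximal non-empty set $X$ of consecutive integers with $X\cap S=\emptyset$, $\min S<\min X$ and $\max S>\max X$; its size is $|X|$. *)

theory Defs
  imports Main "HOL-Library.Multiset"
begin

definition fin_graph :: "'a set \<Rightarrow> 'a set set \<Rightarrow> bool" where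
  "fin_graph V E \<longleftrightarrow> finite V \<and> (\<forall>e\<in>E. e \<subseteq> V \<and> card e = 2)"

text \<open>The empty set counts as a set of consecutive integers, so isolated vertices
  impose no condition on a coloring.\<close>

definition consecutive :: "int set \<Rightarrow> bool" where
  "consecutive X \<longleftrightarrow> (\<exists>a b. X = {a..b})"

text \<open>The equation of multisets forces the edges at a vertex to receive pairwise
  distinct colors.\<close>

definition interval_coloring :: "'a set \<Rightarrow> 'a set set \<Rightarrow> ('a set \<Rightarrow> int) \<Rightarrow> bool" where
  "interval_coloring V E c \<longleftrightarrow>
     (\<forall>x\<in>V. \<exists>X. consecutive X \<and> image_mset c (mset_set {e \<in> E. x \<in> e}) = mset_set X)"

definition t_interval_colorable :: "'a set \<Rightarrow> 'a set set \<Rightarrow> int \<Rightarrow> bool" where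
  "t_interval_colorable V E t \<longleftrightarrow>
     (\<exists>c. interval_coloring V E c \<and> int (card (c ` E)) = t)"

definition interval_spectrum :: "'a set \<Rightarrow> 'a set set \<Rightarrow> int set" where
  "interval_spectrum V E = {t. t_interval_colorable V E t}"

definition gap_candidate :: "int set \<Rightarrow> int set \<Rightarrow> bool" where
  "gap_candidate S X \<longleftrightarrow>
     X \<noteq> {} \<and> consecutive X \<and> X \<inter> S = {} \<and> Min S < Min X \<and> Max S > Max X"

text \<open>Gaps are only considered for finite non-empty sets, where the minimum and maximum are
  meaningful; the spectrum of a finite graph is always finite.\<close>

definition gaps :: "int set \<Rightarrow> int set set" where
  "gaps S = {X. finite S \<and> S \<noteq> {} \<and> gap_candidate S X \<and>
                (\<forall>Y. gap_candidate S Y \<and> X \<subseteq> Y \<longrightarrow> Y = X)}"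

lemma finite_edges: "fin_graph V E \<Longrightarrow> finite E"
  unfolding fin_graph_def by (meson Pow_iff finite_Pow_iff finite_subset subsetI)

lemma finite_interval_spectrum:
  assumes "fin_graph V E"
  shows "finite (interval_spectrum V E)"
proof (rule finite_subset)
  show "interval_spectrum V E \<subseteq> int ` {..card E}"
    using card_image_le[OF finite_edges[OF assms]]
    by (auto simp: interval_spectrum_def t_interval_colorable_def)
qed simp

end

theory Submission
  imports Defs "HOL-Library.Countable" "HOL-Library.Disjoint_Sets"
begin

text \<open>
  Delete an edge \<open>uw\<close> from \<open>K\<^bsub>p,q\<^esub>\<close>, where \<open>p\<close> divides \<open>q\<close>, and hang a pendant edge on each of \<open>u\<close>
  and \<open>w\<close>. In an interval coloring, summing all colors once over the left and once over the right
  vertices shows that the two pendant colors agree modulo \<open>p\<close>; they differ by at most \<open>p + q\<close>, and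
  if they differ by exactly \<open>p + q\<close>, then the colors used are precisely those between them.

  A gadget consists of such a \<open>K\<^bsub>n,2n\<^esub>\<close> and such a \<open>K\<^bsub>n',n'\<^esub>\<close> that share one pendant edge and whose
  other pendant edges meet in a hub. The displacements \<open>i n\<close> and \<open>j n'\<close> of the two parts
  (\<open>\<bar>i\<bar> \<le> 3\<close>, \<open>\<bar>j\<bar> \<le> 2\<close>) differ by less than the hub degree but are not equal, since the hub edges
  have distinct colors. With \<open>n = 2 s + 1\<close>, \<open>n' = 3 s + g + 1\<close> and \<open>s\<close> large this forces \<open>2 i = 3 j\<close>
  and hence \<open>(i, j) = \<plusminus>(3, 2)\<close>: the gadget extends rigidly upwards or downwards from the hub by
  about \<open>6 s\<close>, and its two hub edges have colors differing by \<open>2 g - 1\<close>.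

  Join gadgets \<open>g = 1, \<dots>, k + 1\<close> with \<open>s = g S\<close> at one hub. The hub sees only \<open>2 (k + 1)\<close>
  consecutive colors, so the pairs of hub edges are nested. The number of colors is then determined
  by the largest gadget together with the largest one pointing the opposite way, if there is any. So
  the spectrum has exactly \<open>k + 1\<close> elements, with distances of about \<open>6 S\<close>.
\<close>

subsection \<open>Functions with consecutive values\<close>

definition consecutive_on :: "('a \<Rightarrow> int) \<Rightarrow> 'a set \<Rightarrow> bool" where
  "consecutive_on f I \<longleftrightarrow> inj_on f I \<and> consecutive (f ` I)"

lemma consecutive_iff_atLeastLessThan: "consecutive X \<longleftrightarrow> (\<exists>a b. a \<le> b \<and> X = {a..<b})"
proof
  assume "consecutive X"
  then obtain a b where "X = {a..b}" by (auto simp: consecutive_def)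
  then have "X = {a..<max a (b + 1)}" by auto
  then show "\<exists>a b. a \<le> b \<and> X = {a..<b}" by (metis max.cobounded1)
next
  assume "\<exists>a b. a \<le> b \<and> X = {a..<b}"
  then obtain a b where "X = {a..<b}" by blast
  then have "X = {a..b - 1}" by auto
  then show "consecutive X" by (auto simp: consecutive_def)
qed

lemma consecutive_onE:
  assumes "consecutive_on f I"
  obtains a where "f ` I = {a..<a + int (card I)}"
proof -
  obtain a b where ab: "f ` I = {a..<b}" "a \<le> b"
    using assms by (auto simp: consecutive_on_def consecutive_iff_atLeastLessThan)
  have "card I = card {a..<b}"
    using assms ab(1) card_image[of f I] by (simp add: consecutive_on_def)
  then have "b = a + int (card I)" using ab(2) by simp
  then show thesis using ab(1) that by blast
qed

lemma consecutive_on_diff_less: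
  assumes "consecutive_on f I" "x \<in> I" "y \<in> I"
  shows "f x - f y < int (card I)"
proof -
  obtain a where a: "f ` I = {a..<a + int (card I)}"
    using assms(1) by (rule consecutive_onE)
  then have "f x \<in> {a..<a + int (card I)}" "f y \<in> {a..<a + int (card I)}"
    using assms(2,3) by blast+
  then show ?thesis by simp
qed

lemma consecutive_on_image_Min:
  assumes "consecutive_on f I" "x \<in> I" "\<And>y. y \<in> I \<Longrightarrow> f x \<le> f y"
  shows "f ` I = {f x..<f x + int (card I)}"
proof -
  obtain a where a: "f ` I = {a..<a + int (card I)}"
    using assms(1) by (rule consecutive_onE)
  have x: "f x \<in> {a..<a + int (card I)}"
    using a assms(2) by blast
  then have "a \<in> f ` I" using a by simp
  then have "f x \<le> a" using assms(3) by blast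
  then show ?thesis using a x by simp
qed

lemma consecutive_on_adjacent:
  assumes "consecutive_on f I" "x \<in> I" "2 \<le> card I"
  obtains y where "y \<in> I" "y \<noteq> x" "\<bar>f y - f x\<bar> = 1"
proof -
  obtain a where a: "f ` I = {a..<a + int (card I)}"
    using assms(1) by (rule consecutive_onE)
  then have "f x \<in> {a..<a + int (card I)}" using assms(2) by blast
  then have "f x + 1 \<in> f ` I \<or> f x - 1 \<in> f ` I"
    using assms(3) unfolding a by auto
  then show thesis using that by fastforce
qed

lemma double_sum_consecutive_interval:
  "2 * \<Sum>{a..<a + int n} = int n * (2 * a + int n - 1)"
proof (induction n)
  case (Suc n)
  have "{a..<a + int (Suc n)} = insert (a + int n) {a..<a + int n}" by auto
  then show ?case using Suc by (simp add: algebra_simps)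
qed simp

lemma double_sum_consecutive_on_rows:
  assumes "\<And>i. i \<in> I \<Longrightarrow> consecutive_on (f i) J"
  shows "\<exists>a. 2 * (\<Sum>i\<in>I. \<Sum>j\<in>J. f i j) = int (card J) * (2 * a + int (card I) * (int (card J) - 1))"
proof -
  have "\<exists>a. 2 * sum (f i) J = int (card J) * (2 * a + int (card J) - 1)" if "i \<in> I" for i
  proof -
    have row: "consecutive_on (f i) J" using assms that by blast
    then obtain a where "f i ` J = {a..<a + int (card J)}" by (rule consecutive_onE)
    moreover have "sum (f i) J = \<Sum>(f i ` J)"
      using row by (simp add: consecutive_on_def sum.reindex)
    ultimately show ?thesis using double_sum_consecutive_interval by metis
  qed
  then obtain a where a: "\<And>i. i \<in> I \<Longrightarrow> 2 * sum (f i) J = int (card J) * (2 * a i + int (card J) - 1)"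
    by metis
  have "2 * (\<Sum>i\<in>I. \<Sum>j\<in>J. f i j) = (\<Sum>i\<in>I. int (card J) * (2 * a i + int (card J) - 1))"
    by (simp add: a sum_distrib_left[of 2 _ I])
  also have "\<dots> = int (card J) * (2 * sum a I + int (card I) * (int (card J) - 1))"
    by (simp add: sum.distrib sum_subtractf flip: sum_distrib_left) (simp add: algebra_simps)
  finally show ?thesis by blast
qed

lemma consecutive_on_affine:
  assumes "consecutive_on f I" "\<bar>\<sigma>\<bar> = 1"
  shows "consecutive_on (\<lambda>x. b + \<sigma> * f x) I"
proof -
  obtain x y where xy: "f ` I = {x..y}"
    using assms(1) by (auto simp: consecutive_on_def consecutive_def)
  have \<sigma>: "\<sigma> = 1 \<or> \<sigma> = -1" using assms(2) by linarith
  have "(\<lambda>x. b + \<sigma> * f x) ` I = (\<lambda>z. b + \<sigma> * z) ` {x..y}"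
    unfolding xy[symmetric] by (simp add: image_image)
  also have "\<dots> = (if \<sigma> = 1 then {x + b..y + b} else {b - y..b - x})"
    using \<sigma> by auto
  finally have "consecutive ((\<lambda>x. b + \<sigma> * f x) ` I)" by (auto simp: consecutive_def)
  then show ?thesis using assms(1) \<sigma> by (auto simp: consecutive_on_def inj_on_def)
qed

lemma consecutive_on_uminus: "consecutive_on f I \<Longrightarrow> consecutive_on (\<lambda>x. - f x) I"
  using consecutive_on_affine[of f I "-1" 0] by simp

lemma consecutive_on_translate: "consecutive_on f I \<Longrightarrow> consecutive_on (\<lambda>x. b + f x) I"
  using consecutive_on_affine[of f I 1 b] by simp

lemma consecutive_on_image_Max:
  assumes "consecutive_on f I" "x \<in> I" "\<And>y. y \<in> I \<Longrightarrow> f y \<le> f x"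
  shows "f ` I = {f x - int (card I)<..f x}"
proof -
  have "(\<lambda>x. - f x) ` I = {- f x..<- f x + int (card I)}"
    using consecutive_on_uminus assms by (intro consecutive_on_image_Min) auto
  then have "uminus ` (\<lambda>x. - f x) ` I = uminus ` {- f x..<- f x + int (card I)}" by simp
  then show ?thesis by (simp add: image_image)
qed

lemma consecutive_on_image_iff:
  assumes "inj_on h A"
  shows "consecutive_on f (h ` A) \<longleftrightarrow> consecutive_on (\<lambda>x. f (h x)) A"
  using comp_inj_on_iff[OF assms, of f] by (simp add: consecutive_on_def image_image comp_def)

lemma consecutive_on_int: "consecutive_on int {..<n}"
proof -
  have "int ` {..<n} = {0..int n - 1}"
    by (auto simp: lessThan_atLeast0 image_int_atLeastLessThan)
  then show ?thesis by (auto simp: consecutive_on_def consecutive_def)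
qed

definition wrap :: "nat \<Rightarrow> nat \<Rightarrow> nat" where
  "wrap n j = (if j = 0 then n else j)"

lemma consecutive_on_wrap: "consecutive_on (\<lambda>j. int (wrap n j)) {..<n}"
proof -
  have inj: "inj_on (wrap n) {..<n}"
    by (auto simp: inj_on_def wrap_def split: if_splits)
  have "wrap n ` {..<n} \<subseteq> {1..n}" by (auto simp: wrap_def)
  then have "wrap n ` {..<n} = {1..n}"
    using inj by (intro card_subset_eq) (simp_all add: card_image)
  then have "consecutive_on int (wrap n ` {..<n})"
    by (simp add: consecutive_on_def consecutive_def image_int_atLeastAtMost) blast
  then show ?thesis by (simp add: consecutive_on_image_iff[OF inj])
qed

subsection \<open>Complete bipartite graphs with two ports\<close>

text \<open>\<open>R i j\<close> and \<open>C i j\<close> are the colors of the edge between row vertex \<open>i\<close> and column vertex \<open>j\<close>,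
  as seen from either end. The edge between the vertices \<open>0\<close> is absent: its two places hold the
  colors of the pendant edges.\<close>

definition grid_colors :: "nat \<Rightarrow> nat \<Rightarrow> (nat \<Rightarrow> nat \<Rightarrow> int) \<Rightarrow> (nat \<Rightarrow> nat \<Rightarrow> int) \<Rightarrow> int set" where
  "grid_colors p q R C = (\<Union>i\<in>{..<p}. \<Union>j\<in>{..<q}. {R i j, C i j})"

lemma grid_colors_uminus:
  "grid_colors p q (\<lambda>i j. - R i j) (\<lambda>i j. - C i j) = uminus ` grid_colors p q R C"
  by (simp add: grid_colors_def image_UN)

lemma grid_colors_dual:
  "grid_colors q p (\<lambda>i j. - C j i) (\<lambda>i j. - R j i) = uminus ` grid_colors p q R C"
  unfolding grid_colors_def by blast

locale ported_grid =
  fixes p q :: nat and R C :: "nat \<Rightarrow> nat \<Rightarrow> int"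
  assumes two_le_p: "2 \<le> p" and two_le_q: "2 \<le> q"
    and rows: "\<And>i. i < p \<Longrightarrow> consecutive_on (R i) {..<q}"
    and cols: "\<And>j. j < q \<Longrightarrow> consecutive_on (\<lambda>i. C i j) {..<p}"
    and agree: "\<And>i j. i < p \<Longrightarrow> j < q \<Longrightarrow> i \<noteq> 0 \<or> j \<noteq> 0 \<Longrightarrow> R i j = C i j"
begin

lemma ported_grid_affine:
  assumes "\<bar>\<sigma>\<bar> = 1"
  shows "ported_grid p q (\<lambda>i j. b + \<sigma> * R i j) (\<lambda>i j. b + \<sigma> * C i j)"
  using two_le_p two_le_q assms
  by unfold_locales (auto intro: consecutive_on_affine rows cols simp: agree)

lemma ported_grid_uminus: "ported_grid p q (\<lambda>i j. - R i j) (\<lambda>i j. - C i j)"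
  using ported_grid_affine[of "-1" 0] by simp

lemma ported_grid_dual: "ported_grid q p (\<lambda>i j. - C j i) (\<lambda>i j. - R j i)"
  using two_le_p two_le_q
  by unfold_locales (auto intro: consecutive_on_uminus rows cols simp: agree)

lemma port_difference_dvd:
  assumes "p dvd q"
  shows "int p dvd C 0 0 - R 0 0"
proof -
  obtain m where m: "q = p * m" using assms by blast
  obtain a where a: "2 * (\<Sum>i<p. \<Sum>j<q. R i j) = int q * (2 * a + int p * (int q - 1))"
    using double_sum_consecutive_on_rows[of "{..<p}" R "{..<q}"] rows by auto
  have "\<exists>b. 2 * (\<Sum>i<p. \<Sum>j<q. C i j) = int p * (2 * b + int q * (int p - 1))"
    using double_sum_consecutive_on_rows[of "{..<q}" "\<lambda>j i. C i j" "{..<p}"] cols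
    by (subst sum.swap) auto
  then obtain b where b: "2 * (\<Sum>i<p. \<Sum>j<q. C i j) = int p * (2 * b + int q * (int p - 1))"
    by blast
  have "(\<Sum>i<p. \<Sum>j<q. C i j) - (\<Sum>i<p. \<Sum>j<q. R i j) = (\<Sum>i<p. \<Sum>j<q. C i j - R i j)"
    by (simp add: sum_subtractf)
  also have "\<dots> = (\<Sum>i<p. \<Sum>j<q. if i = 0 \<and> j = 0 then C 0 0 - R 0 0 else 0)"
    by (intro sum.cong) (auto simp: agree)
  also have "\<dots> = (\<Sum>i<p. if i = 0 then C 0 0 - R 0 0 else 0)"
    using two_le_q by (intro sum.cong) auto
  also have "\<dots> = C 0 0 - R 0 0" using two_le_p by simp
  finally have diff: "C 0 0 - R 0 0 = (\<Sum>i<p. \<Sum>j<q. C i j) - (\<Sum>i<p. \<Sum>j<q. R i j)" ..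
  have "even (int m * (int m - 1))" by simp
  then obtain l where l: "int m * (int m - 1) = 2 * l" by blast
  have "2 * (C 0 0 - R 0 0) =
      int p * (2 * b - 2 * int m * a - int p * int p * (int m * (int m - 1)))"
    unfolding diff right_diff_distrib a b by (simp add: m algebra_simps)
  then have "C 0 0 - R 0 0 = int p * (b - int m * a - int p * int p * l)"
    unfolding l by (simp add: algebra_simps)
  then show ?thesis by simp
qed

lemma col_row_difference_le:
  assumes "0 < i" "i < p" "0 < j" "j < q"
  shows "C i 0 - R 0 j \<le> int p + int q - 2"
proof -
  have "R i 0 - R i j < int q"
    using consecutive_on_diff_less[OF rows, of i 0 j] assms by simp
  moreover have "C i j - C 0 j < int p"
    using consecutive_on_diff_less[OF cols, of j i 0] assms by simp
  ultimately show ?thesis using assms by (simp add: agree)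
qed

lemma row_adjacent_to_port:
  obtains j where "0 < j" "j < q" "\<bar>R 0 j - R 0 0\<bar> = 1"
proof (rule consecutive_on_adjacent[OF rows, of 0 0])
  fix j assume "j \<in> {..<q}" "j \<noteq> 0" "\<bar>R 0 j - R 0 0\<bar> = 1"
  then show thesis by (intro that) auto
qed (use two_le_p two_le_q in auto)

lemma col_adjacent_to_port:
  obtains i where "0 < i" "i < p" "\<bar>C i 0 - C 0 0\<bar> = 1"
proof (rule ported_grid.row_adjacent_to_port[OF ported_grid_dual])
  fix i assume "0 < i" "i < p" "\<bar>- C i 0 - - C 0 0\<bar> = 1"
  then show thesis by (intro that) auto
qed

lemma port_difference_le: "C 0 0 - R 0 0 \<le> int p + int q"
proof -
  obtain j where "0 < j" "j < q" "\<bar>R 0 j - R 0 0\<bar> = 1" by (rule row_adjacent_to_port)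
  moreover obtain i where "0 < i" "i < p" "\<bar>C i 0 - C 0 0\<bar> = 1" by (rule col_adjacent_to_port)
  ultimately show ?thesis using col_row_difference_le[of i j] by linarith
qed

lemma abs_port_difference_le: "\<bar>C 0 0 - R 0 0\<bar> \<le> int p + int q"
  using port_difference_le ported_grid.port_difference_le[OF ported_grid_uminus] by linarith

lemma tight_row_image:
  assumes "C 0 0 = R 0 0 + int p + int q"
  shows "R 0 ` {..<q} = {R 0 0..<R 0 0 + int q}"
proof -
  obtain i where i: "0 < i" "i < p" "\<bar>C i 0 - C 0 0\<bar> = 1" by (rule col_adjacent_to_port)
  have "R 0 0 \<le> R 0 j" if "j < q" for j
    using col_row_difference_le[OF i(1,2), of j] i(3) assms that by (cases "j = 0") auto
  then show ?thesis
    using consecutive_on_image_Min[OF rows, of 0 0] two_le_p two_le_q by simp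
qed

lemma tight_col_image:
  assumes "C 0 0 = R 0 0 + int p + int q"
  shows "(\<lambda>i. C i 0) ` {..<p} = {C 0 0 - int p<..C 0 0}"
proof -
  have "(\<lambda>i. - C i 0) ` {..<p} = {- C 0 0..<- C 0 0 + int p}"
    using assms by (intro ported_grid.tight_row_image[OF ported_grid_dual]) simp
  then have "uminus ` (\<lambda>i. - C i 0) ` {..<p} = uminus ` {- C 0 0..<- C 0 0 + int p}" by simp
  then show ?thesis by (simp add: image_image)
qed

lemma tight_row_mem:
  assumes tight: "C 0 0 = R 0 0 + int p + int q" and ij: "i < p" "j < q"
  shows "R i j \<in> {R 0 0..C 0 0}" and "0 < i \<Longrightarrow> R i j < C 0 0"
proof -
  have row: "R 0 j \<in> {R 0 0..<R 0 0 + int q}" if "j < q" for j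
    using tight_row_image[OF tight] that by blast
  have col: "C i 0 \<in> {C 0 0 - int p<..C 0 0}"
    using tight_col_image[OF tight] ij by blast
  have interior: "R i j \<in> {R 0 0..<C 0 0}" if "0 < i" "0 < j"
  proof -
    have "R i 0 - R i j < int q"
      using consecutive_on_diff_less[OF rows, of i 0 j] ij by simp
    moreover have "C i j - C 0 j < int p"
      using consecutive_on_diff_less[OF cols, of j i 0] ij by simp
    ultimately show ?thesis using row[OF ij(2)] col ij that tight by (simp add: agree)
  qed
  have "C i 0 \<noteq> C 0 0" if "0 < i"
    using cols[of 0] that ij two_le_q inj_on_eq_iff[of "\<lambda>i. C i 0" "{..<p}" i 0]
    by (auto simp: consecutive_on_def)
  then have border: "R i 0 \<in> {R 0 0..<C 0 0}" if "0 < i"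
    using col ij that tight by (auto simp: agree)
  show "0 < i \<Longrightarrow> R i j < C 0 0" using interior border by (cases "j = 0") auto
  show "R i j \<in> {R 0 0..C 0 0}"
    using interior border row[OF ij(2)] tight by (cases "i = 0"; cases "j = 0") auto
qed

lemma tight_grid_colors_subset:
  assumes "C 0 0 = R 0 0 + int p + int q"
  shows "grid_colors p q R C \<subseteq> {R 0 0..C 0 0}"
proof -
  have "C i j \<in> {R 0 0..C 0 0}" if "i < p" "j < q" for i j
    using tight_row_mem(1)[OF assms that] agree[OF that] assms by (cases "i = 0 \<and> j = 0") auto
  then show ?thesis
    using tight_row_mem(1)[OF assms] unfolding grid_colors_def by blast
qed

text \<open>The first row and the first column miss only the color \<open>R 0 0 + q = C 0 0 - p\<close>. It occurs in
  the row that meets the first column in color \<open>C 0 0 - 1\<close>.\<close>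

lemma tight_grid_colors_supset:
  assumes tight: "C 0 0 = R 0 0 + int p + int q" and "p \<le> q"
  shows "{R 0 0..C 0 0} \<subseteq> grid_colors p q R C"
proof
  fix x assume x: "x \<in> {R 0 0..C 0 0}"
  have "C 0 0 - 1 \<in> (\<lambda>i. C i 0) ` {..<p}"
    using two_le_p unfolding tight_col_image[OF tight] by simp
  then obtain i where i: "i < p" "C i 0 = C 0 0 - 1" by auto
  then have "0 < i" by (intro gr0I) auto
  then have "R i j \<le> R i 0" if "j < q" for j
    using tight_row_mem(2)[OF tight i(1) that] agree[of i 0] i two_le_q by simp
  then have row: "R i ` {..<q} = {C 0 0 - 1 - int q<..C 0 0 - 1}"
    using consecutive_on_image_Max[OF rows[OF i(1)], of 0] agree[of i 0] i \<open>0 < i\<close> two_le_q by simp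
  have "x \<in> R 0 ` {..<q} \<or> x \<in> (\<lambda>i. C i 0) ` {..<p} \<or> x \<in> R i ` {..<q}"
    using x tight \<open>p \<le> q\<close> two_le_p unfolding row tight_row_image[OF tight] tight_col_image[OF tight]
    by auto
  then show "x \<in> grid_colors p q R C"
    using i(1) two_le_p two_le_q unfolding grid_colors_def by force
qed

lemma tight_grid_colors:
  assumes "C 0 0 = R 0 0 + int p + int q"
  shows "grid_colors p q R C = {R 0 0..C 0 0}"
proof (rule antisym[OF tight_grid_colors_subset[OF assms]])
  show "{R 0 0..C 0 0} \<subseteq> grid_colors p q R C"
  proof (cases "p \<le> q")
    case False
    have "{- C 0 0..- R 0 0} \<subseteq> grid_colors q p (\<lambda>i j. - C j i) (\<lambda>i j. - R j i)"
      using assms False by (intro ported_grid.tight_grid_colors_supset[OF ported_grid_dual]) auto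
    then have "uminus ` {- C 0 0..- R 0 0} \<subseteq> uminus ` uminus ` grid_colors p q R C"
      unfolding grid_colors_dual by (rule image_mono)
    then show ?thesis by (simp add: image_image)
  qed (rule tight_grid_colors_supset[OF assms])
qed

lemma abs_tight_grid_colors:
  assumes "\<bar>C 0 0 - R 0 0\<bar> = int p + int q"
  shows "grid_colors p q R C = {min (R 0 0) (C 0 0)..max (R 0 0) (C 0 0)}"
proof (cases "R 0 0 \<le> C 0 0")
  case True
  then show ?thesis using tight_grid_colors assms by simp
next
  case False
  have "grid_colors p q (\<lambda>i j. - R i j) (\<lambda>i j. - C i j) = {- R 0 0..- C 0 0}"
    using False assms by (intro ported_grid.tight_grid_colors[OF ported_grid_uminus]) simp
  then have "uminus ` uminus ` grid_colors p q R C = uminus ` {- R 0 0..- C 0 0}"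
    by (simp only: grid_colors_uminus)
  then show ?thesis using False by (simp add: image_image)
qed

end

lemma ported_grid_ascending:
  assumes "2 \<le> p" "2 \<le> q"
  shows "ported_grid p q
    (\<lambda>i j. if i = 0 \<and> j = 0 then 0 else int i + int (wrap q j))
    (\<lambda>i j. if i = 0 \<and> j = 0 then int p + int q else int i + int (wrap q j))"
    (is "ported_grid p q ?R ?C")
proof
  fix i assume "i < p"
  have "?R i = (if i = 0 then int else (\<lambda>j. int i + int (wrap q j)))"
    by (auto simp: wrap_def)
  then show "consecutive_on (?R i) {..<q}"
    by (simp add: consecutive_on_int consecutive_on_translate consecutive_on_wrap)
next
  fix j assume "j < q"
  have "(\<lambda>i. ?C i j) = (if j = 0 then (\<lambda>i. int q + int (wrap p i)) else (\<lambda>i. int j + int i))"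
    by (auto simp: wrap_def)
  then show "consecutive_on (\<lambda>i. ?C i j) {..<p}"
    by (simp add: consecutive_on_int consecutive_on_translate consecutive_on_wrap)
qed (use assms in auto)

subsection \<open>Colorings and spectra\<close>

lemma consecutive_mset_iff:
  assumes "finite D"
  shows "(\<exists>X. consecutive X \<and> image_mset c (mset_set D) = mset_set X) \<longleftrightarrow> consecutive_on c D"
proof
  assume "\<exists>X. consecutive X \<and> image_mset c (mset_set D) = mset_set X"
  then obtain X where X: "consecutive X" "image_mset c (mset_set D) = mset_set X" by blast
  then have "finite X" by (auto simp: consecutive_def)
  then have "c ` D = X" using arg_cong[OF X(2), of set_mset] assms by simp
  moreover have "card D = card X" using arg_cong[OF X(2), of size] by simp
  ultimately show "consecutive_on c D"
    using assms X(1) by (auto simp: consecutive_on_def intro: eq_card_imp_inj_on)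
next
  assume "consecutive_on c D"
  then show "\<exists>X. consecutive X \<and> image_mset c (mset_set D) = mset_set X"
    by (auto simp: consecutive_on_def image_mset_mset_set)
qed

lemma interval_coloring_iff:
  assumes "finite E"
  shows "interval_coloring V E c \<longleftrightarrow> (\<forall>v\<in>V. consecutive_on c {e \<in> E. v \<in> e})"
  using assms by (simp add: interval_coloring_def consecutive_mset_iff)

lemma interval_spectrum_reindex:
  assumes "finite S" "inj_on e S"
  shows "interval_spectrum V (e ` S) =
    {int (card (\<kappa> ` S)) |\<kappa>. \<forall>v\<in>V. consecutive_on \<kappa> {s \<in> S. v \<in> e s}}"
proof -
  have coloring: "interval_coloring V (e ` S) c \<longleftrightarrow>
      (\<forall>v\<in>V. consecutive_on (\<lambda>s. c (e s)) {s \<in> S. v \<in> e s})" for c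
  proof -
    have "{y \<in> e ` S. v \<in> y} = e ` {s \<in> S. v \<in> e s}" for v by blast
    moreover have "inj_on e {s \<in> S. v \<in> e s}" for v
      using assms(2) by (rule inj_on_subset) blast
    ultimately show ?thesis
      using assms(1) by (simp add: interval_coloring_iff consecutive_on_image_iff)
  qed
  show ?thesis
  proof (intro equalityI subsetI)
    fix t assume "t \<in> interval_spectrum V (e ` S)"
    then obtain c where "interval_coloring V (e ` S) c" "int (card (c ` e ` S)) = t"
      by (auto simp: interval_spectrum_def t_interval_colorable_def)
    then show "t \<in> {int (card (\<kappa> ` S)) |\<kappa>. \<forall>v\<in>V. consecutive_on \<kappa> {s \<in> S. v \<in> e s}}"
      unfolding coloring image_image by blast
  next
    fix t assume "t \<in> {int (card (\<kappa> ` S)) |\<kappa>. \<forall>v\<in>V. consecutive_on \<kappa> {s \<in> S. v \<in> e s}}"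
    then obtain \<kappa> where \<kappa>: "t = int (card (\<kappa> ` S))"
      "\<And>v. v \<in> V \<Longrightarrow> consecutive_on \<kappa> {s \<in> S. v \<in> e s}" by blast
    define c where "c y = \<kappa> (inv_into S e y)" for y
    have c: "c (e s) = \<kappa> s" if "s \<in> S" for s
      using assms(2) that by (simp add: c_def)
    then have "consecutive_on (\<lambda>s. c (e s)) {s \<in> S. v \<in> e s}" if "v \<in> V" for v
      using \<kappa>(2)[OF that] by (simp add: consecutive_on_def inj_on_def cong: image_cong_simp)
    then have "interval_coloring V (e ` S) c" using coloring by blast
    moreover have "t = int (card (c ` e ` S))" using c \<kappa>(1) by (simp add: image_image)
    ultimately show "t \<in> interval_spectrum V (e ` S)"
      by (auto simp: interval_spectrum_def t_interval_colorable_def)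
  qed
qed

lemma interval_spectrum_image:
  assumes "finite E" "inj h"
  shows "interval_spectrum (h ` V) ((`) h ` E) = interval_spectrum V E"
proof -
  have "inj_on ((`) h) E" using assms(2) by (simp add: inj_on_def inj_image_eq_iff)
  then show ?thesis
    using interval_spectrum_reindex[OF assms(1), of "(`) h"]
      interval_spectrum_reindex[OF assms(1), of id]
    by (simp add: inj_image_mem_iff[OF assms(2)])
qed

lemma fin_graph_image:
  assumes "inj h" "fin_graph V E"
  shows "fin_graph (h ` V) ((`) h ` E)"
  using assms by (auto simp: fin_graph_def card_image inj_on_subset)

subsection \<open>Gaps of an increasing sequence\<close>

lemma gap_candidate_strict_mono_iff:
  fixes v :: "nat \<Rightarrow> int"
  assumes "strict_mono v"
  shows "gap_candidate (v ` {..k}) X \<longleftrightarrow>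
    X \<noteq> {} \<and> consecutive X \<and> (\<exists>i<k. X \<subseteq> {v i<..<v (Suc i)})"
proof -
  note less = strict_mono_less[OF assms] and le = strict_mono_less_eq[OF assms]
  have Min: "Min (v ` {..k}) = v 0" by (rule Min_eqI) (auto simp: le)
  have Max: "Max (v ` {..k}) = v k" by (rule Max_eqI) (auto simp: le)
  show ?thesis
  proof
    assume X: "gap_candidate (v ` {..k}) X"
    then obtain a b where ab: "X = {a..b}" "a \<le> b" by (auto simp: gap_candidate_def consecutive_def)
    then have "Min X = a" "Max X = b" by (auto intro: Min_eqI Max_eqI)
    then have "v 0 < a" "b < v k" using X by (simp_all add: gap_candidate_def Min Max)
    then have "\<exists>i<k. (\<forall>j\<le>i. \<not> a \<le> v j) \<and> a \<le> v (Suc i)"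
      using ab(2) by (intro ex_least_nat_less) auto
    then obtain i where i: "i < k" "v i < a" "a \<le> v (Suc i)" by force
    have "v (Suc i) \<notin> X" using X i(1) by (auto simp: gap_candidate_def)
    then have "X \<subseteq> {v i<..<v (Suc i)}" using i ab by auto
    then show "X \<noteq> {} \<and> consecutive X \<and> (\<exists>i<k. X \<subseteq> {v i<..<v (Suc i)})"
      using X i(1) by (auto simp: gap_candidate_def)
  next
    assume X: "X \<noteq> {} \<and> consecutive X \<and> (\<exists>i<k. X \<subseteq> {v i<..<v (Suc i)})"
    then obtain i where i: "i < k" "X \<subseteq> {v i<..<v (Suc i)}" by blast
    have "finite X" using i(2) by (rule finite_subset) simp
    then have "Min X \<in> X" "Max X \<in> X" using X by simp_all
    then have "v i < Min X" "Max X < v (Suc i)" using i(2) by auto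
    moreover have "v 0 \<le> v i" "v (Suc i) \<le> v k" using i(1) by (simp_all add: le)
    moreover have "v j \<notin> {v i<..<v (Suc i)}" for j by (simp add: less)
    then have "X \<inter> v ` {..k} = {}" using i(2) by blast
    ultimately show "gap_candidate (v ` {..k}) X"
      using X by (simp add: gap_candidate_def Min Max)
  qed
qed

context
  fixes v :: "nat \<Rightarrow> int"
  assumes step: "\<And>i. v i + 1 < v (Suc i)"
begin

lemma strict_mono_sparse: "strict_mono v"
  unfolding strict_mono_Suc_iff using step by (smt (verit))

lemma sparse_interval_subset_iff:
  "{v i<..<v (Suc i)} \<subseteq> {v j<..<v (Suc j)} \<longleftrightarrow> i = j"
proof
  assume sub: "{v i<..<v (Suc i)} \<subseteq> {v j<..<v (Suc j)}"
  have "v i + 1 \<in> {v i<..<v (Suc i)}" using step by simp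
  then have "v j \<le> v i" "v i < v (Suc j)" using sub by fastforce+
  then show "i = j"
    using strict_mono_less_eq[OF strict_mono_sparse] strict_mono_less[OF strict_mono_sparse] by simp
qed simp

lemma gaps_sparse: "gaps (v ` {..k}) = (\<lambda>i. {v i<..<v (Suc i)}) ` {..<k}"
proof -
  define G where "G i = {v i<..<v (Suc i)}" for i
  have cand: "gap_candidate (v ` {..k}) X \<longleftrightarrow> X \<noteq> {} \<and> consecutive X \<and> (\<exists>i<k. X \<subseteq> G i)" for X
    unfolding G_def by (rule gap_candidate_strict_mono_iff[OF strict_mono_sparse])
  have "v i + 1 \<in> G i" for i using step by (simp add: G_def)
  moreover have "consecutive (G i)" for i
    unfolding G_def consecutive_def by (metis atLeastAtMostPlus1_int_conv
      atLeastPlusOneLessThan_greaterThanLessThan_int atLeastLessThanPlusOne_atLeastAtMost_int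
      diff_add_cancel)
  ultimately have G: "gap_candidate (v ` {..k}) (G i)" if "i < k" for i
    using that cand by blast
  have sub: "G i \<subseteq> G j \<longleftrightarrow> i = j" for i j
    unfolding G_def by (rule sparse_interval_subset_iff)
  have "X \<in> gaps (v ` {..k}) \<longleftrightarrow> X \<in> G ` {..<k}" for X
  proof
    assume X: "X \<in> gaps (v ` {..k})"
    then obtain i where "i < k" "X \<subseteq> G i" using cand unfolding gaps_def by blast
    then show "X \<in> G ` {..<k}" using X G unfolding gaps_def by blast
  next
    assume "X \<in> G ` {..<k}"
    then obtain i where i: "i < k" "X = G i" by blast
    have "Y = X" if Y: "gap_candidate (v ` {..k}) Y" "X \<subseteq> Y" for Y
    proof -
      obtain j where "Y \<subseteq> G j" using cand Y(1) by blast
      then show ?thesis using sub[of i j] Y(2) i(2) by blast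
    qed
    then show "X \<in> gaps (v ` {..k})" using G i by (auto simp: gaps_def)
  qed
  then show ?thesis unfolding G_def by blast
qed

lemma card_gaps_sparse: "card (gaps (v ` {..k})) = k"
  unfolding gaps_sparse using sparse_interval_subset_iff
  by (subst card_image) (auto intro!: inj_onI)

end

subsection \<open>Gadgets joined at a hub\<close>

datatype part = Oblong | Square

lemma UNIV_part: "UNIV = {Oblong, Square}"
  using part.exhaust by auto

lemma card_UNIV_part: "card (UNIV :: part set) = 2"
  by (simp add: UNIV_part)

lemma part_neq_iff: "s \<noteq> Square \<longleftrightarrow> s = Oblong" "s \<noteq> Oblong \<longleftrightarrow> s = Square"
  by (cases s; simp)+

instance part :: finite
  by standard (simp add: UNIV_part)

instance part :: countable
  by countable_datatype

text \<open>The arguments are the gadget, the part, and the index of the vertex within the part.\<close>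

datatype vertex = Hub | Row nat part nat | Col nat part nat

instance vertex :: countable
  by countable_datatype

datatype slot = HubPort nat part | Joint nat | Inner nat part nat nat

fun edge_of :: "slot \<Rightarrow> vertex set" where
  "edge_of (HubPort g s) = {Hub, Row g s 0}"
| "edge_of (Joint g) = {Col g Oblong 0, Col g Square 0}"
| "edge_of (Inner g s i j) = {Row g s i, Col g s j}"

lemma inj_edge_of: "inj edge_of"
proof (rule injI)
  fix x y assume "edge_of x = edge_of y"
  then show "x = y" by (cases x; cases y) (auto simp: doubleton_eq_iff)
qed

definition row_slot :: "nat \<Rightarrow> part \<Rightarrow> nat \<Rightarrow> nat \<Rightarrow> slot" where
  "row_slot g s i j = (if i = 0 \<and> j = 0 then HubPort g s else Inner g s i j)"

definition col_slot :: "nat \<Rightarrow> part \<Rightarrow> nat \<Rightarrow> nat \<Rightarrow> slot" where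
  "col_slot g s i j = (if i = 0 \<and> j = 0 then Joint g else Inner g s i j)"

abbreviation row_colors :: "(slot \<Rightarrow> int) \<Rightarrow> nat \<Rightarrow> part \<Rightarrow> nat \<Rightarrow> nat \<Rightarrow> int" where
  "row_colors \<kappa> g s \<equiv> \<lambda>i j. \<kappa> (row_slot g s i j)"

abbreviation col_colors :: "(slot \<Rightarrow> int) \<Rightarrow> nat \<Rightarrow> part \<Rightarrow> nat \<Rightarrow> nat \<Rightarrow> int" where
  "col_colors \<kappa> g s \<equiv> \<lambda>i j. \<kappa> (col_slot g s i j)"

lemma port_slots: "row_slot g s 0 0 = HubPort g s" "col_slot g s 0 0 = Joint g"
  by (simp_all add: row_slot_def col_slot_def)

lemma inj_on_row_slot: "inj_on (row_slot g s i) J"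
  by (auto simp: inj_on_def row_slot_def split: if_splits)

lemma inj_on_col_slot: "inj_on (\<lambda>i. col_slot g s i j) I"
  by (auto simp: inj_on_def col_slot_def split: if_splits)

locale gadget_graph =
  fixes I :: "nat set" and p q :: "nat \<Rightarrow> part \<Rightarrow> nat"
  assumes finite_I: "finite I"
    and two_le_p: "\<And>g s. g \<in> I \<Longrightarrow> 2 \<le> p g s"
    and two_le_q: "\<And>g s. g \<in> I \<Longrightarrow> 2 \<le> q g s"
begin

definition gadget_slots :: "nat \<Rightarrow> slot set" where
  "gadget_slots g = (\<Union>s. \<Union>i\<in>{..<p g s}. \<Union>j\<in>{..<q g s}. {row_slot g s i j, col_slot g s i j})"

definition slots :: "slot set" where
  "slots = (\<Union>g\<in>I. gadget_slots g)"

abbreviation edges :: "vertex set set" where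
  "edges \<equiv> edge_of ` slots"

definition verts :: "vertex set" where
  "verts = insert Hub (\<Union>g\<in>I. \<Union>s. Row g s ` {..<p g s} \<union> Col g s ` {..<q g s})"

abbreviation extent :: "nat \<Rightarrow> part \<Rightarrow> int" where
  "extent g s \<equiv> int (p g s) + int (q g s)"

definition slot_coloring :: "(slot \<Rightarrow> int) \<Rightarrow> bool" where
  "slot_coloring \<kappa> \<longleftrightarrow> consecutive_on (\<lambda>(g, s). \<kappa> (HubPort g s)) (I \<times> UNIV) \<and>
    (\<forall>g\<in>I. \<forall>s. ported_grid (p g s) (q g s) (row_colors \<kappa> g s) (col_colors \<kappa> g s))"

lemma finite_slots: "finite slots"
  using finite_I by (auto simp: slots_def gadget_slots_def)

lemma mem_slots_iff:
  "HubPort g s \<in> slots \<longleftrightarrow> g \<in> I"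
  "Joint g \<in> slots \<longleftrightarrow> g \<in> I"
  "Inner g s i j \<in> slots \<longleftrightarrow> g \<in> I \<and> i < p g s \<and> j < q g s \<and> (i \<noteq> 0 \<or> j \<noteq> 0)"
proof -
  have "0 < p g s" "0 < q g s" if "g \<in> I" for s
    using two_le_p[OF that, of s] two_le_q[OF that, of s] by auto
  then show "HubPort g s \<in> slots \<longleftrightarrow> g \<in> I" "Joint g \<in> slots \<longleftrightarrow> g \<in> I"
    "Inner g s i j \<in> slots \<longleftrightarrow> g \<in> I \<and> i < p g s \<and> j < q g s \<and> (i \<noteq> 0 \<or> j \<noteq> 0)"
    by (auto simp: slots_def gadget_slots_def row_slot_def col_slot_def split: if_splits)
qed

lemma mem_verts_iff:
  "Hub \<in> verts"
  "Row g s i \<in> verts \<longleftrightarrow> g \<in> I \<and> i < p g s"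
  "Col g s j \<in> verts \<longleftrightarrow> g \<in> I \<and> j < q g s"
  by (auto simp: verts_def)

lemma fin_graph_verts: "fin_graph verts edges"
proof -
  have "edge_of x \<subseteq> verts \<and> card (edge_of x) = 2" if "x \<in> slots" for x
  proof -
    have "0 < p g s" "0 < q g s" if "g \<in> I" for g s
      using two_le_p[OF that, of s] two_le_q[OF that, of s] by auto
    then show ?thesis
      using that by (cases x) (auto simp: mem_slots_iff mem_verts_iff)
  qed
  moreover have "finite verts" using finite_I by (auto simp: verts_def)
  ultimately show ?thesis by (auto simp: fin_graph_def)
qed

lemma slots_at_Hub: "{x \<in> slots. Hub \<in> edge_of x} = (\<lambda>(g, s). HubPort g s) ` (I \<times> UNIV)"
  (is "?L = ?R")
proof (intro set_eqI)
  fix x show "x \<in> ?L \<longleftrightarrow> x \<in> ?R" by (cases x) (auto simp: mem_slots_iff)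
qed

lemma slots_at_Row:
  assumes "g \<in> I" "i < p g s"
  shows "{x \<in> slots. Row g s i \<in> edge_of x} = row_slot g s i ` {..<q g s}" (is "?L = ?R")
proof (intro set_eqI)
  fix x show "x \<in> ?L \<longleftrightarrow> x \<in> ?R"
    using assms two_le_q[OF assms(1), of s]
    by (cases x) (auto simp: mem_slots_iff row_slot_def image_iff split: if_splits)
qed

lemma slots_at_Col:
  assumes "g \<in> I" "j < q g s"
  shows "{x \<in> slots. Col g s j \<in> edge_of x} = (\<lambda>i. col_slot g s i j) ` {..<p g s}" (is "?L = ?R")
proof (intro set_eqI)
  fix x show "x \<in> ?L \<longleftrightarrow> x \<in> ?R"
    using assms two_le_p[OF assms(1), of s]
    by (cases x; cases s) (auto simp: mem_slots_iff col_slot_def image_iff split: if_splits)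
qed

lemma slot_coloring_iff: "slot_coloring \<kappa> \<longleftrightarrow> (\<forall>v\<in>verts. consecutive_on \<kappa> {x \<in> slots. v \<in> edge_of x})"
proof -
  let ?P = "\<lambda>v. consecutive_on \<kappa> {x \<in> slots. v \<in> edge_of x}"
  have hub: "?P Hub \<longleftrightarrow> consecutive_on (\<lambda>(g, s). \<kappa> (HubPort g s)) (I \<times> UNIV)"
    unfolding slots_at_Hub
    by (subst consecutive_on_image_iff) (auto simp: inj_on_def case_prod_unfold)
  have row: "?P (Row g s i) \<longleftrightarrow> consecutive_on (\<lambda>j. \<kappa> (row_slot g s i j)) {..<q g s}"
    if "g \<in> I" "i < p g s" for g s i
    unfolding slots_at_Row[OF that] by (rule consecutive_on_image_iff[OF inj_on_row_slot])
  have col: "?P (Col g s j) \<longleftrightarrow> consecutive_on (\<lambda>i. \<kappa> (col_slot g s i j)) {..<p g s}"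
    if "g \<in> I" "j < q g s" for g s j
    unfolding slots_at_Col[OF that] by (rule consecutive_on_image_iff[OF inj_on_col_slot])
  have grid: "ported_grid (p g s) (q g s) (row_colors \<kappa> g s) (col_colors \<kappa> g s) \<longleftrightarrow>
      (\<forall>i<p g s. ?P (Row g s i)) \<and> (\<forall>j<q g s. ?P (Col g s j))" if "g \<in> I" for g s
    using row[OF that] col[OF that] two_le_p[OF that] two_le_q[OF that]
    by (auto simp: ported_grid_def row_slot_def col_slot_def)
  have "(\<forall>v\<in>verts. ?P v) \<longleftrightarrow> ?P Hub \<and>
      (\<forall>g\<in>I. \<forall>s. (\<forall>i<p g s. ?P (Row g s i)) \<and> (\<forall>j<q g s. ?P (Col g s j)))"
    unfolding verts_def by blast
  then show ?thesis by (simp add: slot_coloring_def grid hub)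
qed

lemma interval_spectrum_verts:
  "interval_spectrum verts edges = {int (card (\<kappa> ` slots)) |\<kappa>. slot_coloring \<kappa>}"
  unfolding slot_coloring_iff using finite_slots inj_edge_of
  by (intro interval_spectrum_reindex) (auto intro: inj_on_subset)

lemma slot_coloring_hub:
  assumes "slot_coloring \<kappa>"
  shows "consecutive_on (\<lambda>(g, s). \<kappa> (HubPort g s)) (I \<times> UNIV)"
  using assms by (simp add: slot_coloring_def)

lemma slot_coloring_grid:
  assumes "slot_coloring \<kappa>" "g \<in> I"
  shows "ported_grid (p g s) (q g s) (row_colors \<kappa> g s) (col_colors \<kappa> g s)"
  using assms by (simp add: slot_coloring_def)

lemma slot_coloring_uminus:
  assumes "slot_coloring \<kappa>"
  shows "slot_coloring (\<lambda>x. - \<kappa> x)"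
  using slot_coloring_grid[OF assms] consecutive_on_uminus[OF slot_coloring_hub[OF assms]]
  by (auto simp: slot_coloring_def case_prod_unfold intro: ported_grid.ported_grid_uminus)

lemma gadget_colors_eq:
  "\<kappa> ` gadget_slots g = (\<Union>s. grid_colors (p g s) (q g s)
    (row_colors \<kappa> g s) (col_colors \<kappa> g s))"
  by (simp add: gadget_slots_def grid_colors_def image_UN)

lemma abs_tight_gadget_colors:
  assumes "slot_coloring \<kappa>" "g \<in> I"
    and "\<And>s. \<bar>\<kappa> (Joint g) - \<kappa> (HubPort g s)\<bar> = extent g s"
  shows "\<kappa> ` gadget_slots g =
    (\<Union>s. {min (\<kappa> (HubPort g s)) (\<kappa> (Joint g))..max (\<kappa> (HubPort g s)) (\<kappa> (Joint g))})"
  unfolding gadget_colors_eq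
  using assms(3) ported_grid.abs_tight_grid_colors[OF slot_coloring_grid[OF assms(1,2)]]
  by (simp add: port_slots)

lemma Joint_minus_HubPort_multiple:
  assumes "slot_coloring \<kappa>" "g \<in> I" "q g s = r * p g s"
  obtains l where "\<bar>l\<bar> \<le> 1 + int r" "\<kappa> (Joint g) - \<kappa> (HubPort g s) = int (p g s) * l"
proof -
  interpret ported_grid "p g s" "q g s" "row_colors \<kappa> g s" "col_colors \<kappa> g s"
    using assms(1,2) by (rule slot_coloring_grid)
  obtain l where l: "\<kappa> (Joint g) - \<kappa> (HubPort g s) = int (p g s) * l"
    using port_difference_dvd assms(3) by (auto simp: port_slots)
  have "int (p g s) * \<bar>l\<bar> \<le> int (p g s) * (1 + int r)"
    using abs_port_difference_le assms(3) by (simp add: port_slots l abs_mult algebra_simps)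
  then have "\<bar>l\<bar> \<le> 1 + int r" using two_le_p by simp
  then show thesis using l by (rule that)
qed

lemma hub_ports_range:
  assumes "slot_coloring \<kappa>"
  obtains a where "\<And>g s. g \<in> I \<Longrightarrow> \<kappa> (HubPort g s) \<in> {a..<a + 2 * int (card I)}"
proof -
  obtain a where a: "(\<lambda>(g, s). \<kappa> (HubPort g s)) ` (I \<times> UNIV) =
      {a..<a + int (card (I \<times> (UNIV :: part set)))}"
    using slot_coloring_hub[OF assms] by (rule consecutive_onE)
  have "\<kappa> (HubPort g s) \<in> {a..<a + 2 * int (card I)}" if "g \<in> I" for g s
  proof -
    have "\<kappa> (HubPort g s) \<in> (\<lambda>(g, s). \<kappa> (HubPort g s)) ` (I \<times> UNIV)" using that by force
    then show ?thesis unfolding a by (simp add: card_cartesian_product card_UNIV_part)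
  qed
  then show thesis by (rule that)
qed

lemma hub_ports_eq_iff:
  assumes "slot_coloring \<kappa>" "g \<in> I" "h \<in> I"
  shows "\<kappa> (HubPort g s) = \<kappa> (HubPort h t) \<longleftrightarrow> g = h \<and> s = t"
  using slot_coloring_hub[OF assms(1)] assms(2,3)
    inj_on_eq_iff[of "\<lambda>(g, s). \<kappa> (HubPort g s)" "I \<times> UNIV" "(g, s)" "(h, t)"]
  by (simp add: consecutive_on_def)

end

subsection \<open>Rigidity\<close>

lemma close_multiples_cases:
  fixes s g K i j :: int
  assumes "\<bar>i\<bar> \<le> 3" "\<bar>j\<bar> \<le> 2" "1 \<le> g" "g \<le> K" "4 * K + 5 \<le> s"
    and "(2 * s + 1) * i \<noteq> (3 * s + g + 1) * j"
    and "\<bar>(2 * s + 1) * i - (3 * s + g + 1) * j\<bar> < 2 * K"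
  obtains \<sigma> where "\<bar>\<sigma>\<bar> = 1" "i = 3 * \<sigma>" "j = 2 * \<sigma>"
proof -
  define \<delta> where "\<delta> = 2 * i - 3 * j"
  have "(g + 1) * \<bar>j\<bar> \<le> (K + 1) * 2" using assms(2-4) by (intro mult_mono) auto
  then have "\<bar>(g + 1) * j\<bar> \<le> 2 * K + 2" using assms(3) by (simp add: abs_mult)
  moreover have "s * \<delta> = (2 * s + 1) * i - (3 * s + g + 1) * j - i + (g + 1) * j"
    by (simp add: \<delta>_def algebra_simps)
  ultimately have "\<bar>s * \<delta>\<bar> < s" using assms(1,5,7) by linarith
  moreover have "0 < s" using assms(3-5) by linarith
  ultimately have "\<delta> = 0" by (simp add: abs_mult)
  then have "2 * i = 3 * j" by (simp add: \<delta>_def)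
  then have "\<exists>\<sigma>. i = 3 * \<sigma> \<and> j = 2 * \<sigma>" by presburger
  then obtain \<sigma> where \<sigma>: "i = 3 * \<sigma>" "j = 2 * \<sigma>" by blast
  moreover have "\<sigma> \<noteq> 0" using assms(6) \<sigma> by auto
  ultimately show thesis using assms(1) by (intro that) auto
qed

lemma nested_pairs:
  assumes "disjoint_family_on P {0<..K}"
    and "\<And>g. g \<in> {0<..K} \<Longrightarrow> P g \<subseteq> {m - int K..<m + int K}"
    and "\<And>g. g \<in> {0<..K} \<Longrightarrow> \<exists>x. P g = {x, x + 2 * int g - 1}"
    and "g \<in> {0<..K}"
  shows "P g = {m - int g, m + int g - 1}"
  using assms
proof (induction K)
  case (Suc K)
  obtain x where x: "P (Suc K) = {x, x + 2 * int (Suc K) - 1}"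
    using Suc.prems(3)[of "Suc K"] by auto
  then have "{x, x + 2 * int (Suc K) - 1} \<subseteq> {m - int (Suc K)..<m + int (Suc K)}"
    using Suc.prems(2)[of "Suc K"] by simp
  then have "x = m - int (Suc K)" by simp
  then have outer: "P (Suc K) = {m - int (Suc K), m + int (Suc K) - 1}" using x by simp
  have inner: "P h \<subseteq> {m - int K..<m + int K}" if "h \<in> {0<..K}" for h
  proof -
    have "P h \<inter> P (Suc K) = {}"
      using Suc.prems(1) that by (intro disjoint_family_onD) auto
    then show ?thesis using Suc.prems(2)[of h] that unfolding outer by fastforce
  qed
  show ?case
  proof (cases "g = Suc K")
    case False
    have "disjoint_family_on P {0<..K}"
      using Suc.prems(1) by (rule disjoint_family_on_mono[rotated]) auto
    then show ?thesis using inner Suc.prems(3,4) False by (intro Suc.IH) auto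
  qed (use outer in simp)
qed simp

locale gadget_family =
  fixes K S :: nat
  assumes K_pos: "1 \<le> K" and S_large: "4 * K + 5 \<le> S"
begin

definition left_size :: "nat \<Rightarrow> part \<Rightarrow> nat" where
  "left_size g s = (case s of Oblong \<Rightarrow> 2 * (g * S) + 1 | Square \<Rightarrow> 3 * (g * S) + g + 1)"

definition right_size :: "nat \<Rightarrow> part \<Rightarrow> nat" where
  "right_size g s = (case s of Oblong \<Rightarrow> 2 * left_size g Oblong | Square \<Rightarrow> left_size g Square)"

definition reach :: "nat \<Rightarrow> int" where
  "reach g = int g * (6 * int S + 1) + 2"

lemma mono_reach: "mono reach"
  by (auto intro!: monoI simp: reach_def mult_right_mono)

lemma less_reach: "int g < reach g"
proof -
  have "0 \<le> int g * (6 * int S)" by simp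
  then show ?thesis unfolding reach_def distrib_left by linarith
qed

sublocale gadget_graph "{0<..K}" left_size right_size
proof
  fix g s assume "g \<in> {0<..K}"
  moreover have "1 \<le> S" using S_large by simp
  ultimately have "1 \<le> g * S" by simp
  then show "2 \<le> left_size g s" for s by (cases s) (simp_all add: left_size_def)
  from this[of s] show "2 \<le> right_size g s" by (cases s) (simp_all add: right_size_def)
qed simp

lemma extent_eq:
  "extent g Oblong = reach g - int g + 1"
  "extent g Square = reach g + int g"
  by (simp_all add: right_size_def left_size_def reach_def algebra_simps)

lemma Joint_extreme:
  assumes "slot_coloring \<kappa>" "g \<in> {0<..K}"
  obtains \<sigma> where "\<bar>\<sigma>\<bar> = 1" "\<And>s. \<kappa> (Joint g) = \<kappa> (HubPort g s) + \<sigma> * extent g s"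
proof -
  let ?n = "int (left_size g Oblong)" and ?n' = "int (left_size g Square)"
  obtain i where i: "\<bar>i\<bar> \<le> 3" "\<kappa> (Joint g) - \<kappa> (HubPort g Oblong) = ?n * i"
    using Joint_minus_HubPort_multiple[OF assms, of Oblong 2] by (auto simp: right_size_def)
  obtain j where j: "\<bar>j\<bar> \<le> 2" "\<kappa> (Joint g) - \<kappa> (HubPort g Square) = ?n' * j"
    using Joint_minus_HubPort_multiple[OF assms, of Square 1] by (auto simp: right_size_def)
  obtain a where a: "\<And>h s. h \<in> {0<..K} \<Longrightarrow> \<kappa> (HubPort h s) \<in> {a..<a + 2 * int (card {0<..K})}"
    using hub_ports_range[OF assms(1)] by blast
  have "?n * i \<noteq> ?n' * j"
    using hub_ports_eq_iff[OF assms assms(2), of Oblong Square] i j by auto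
  moreover have "\<bar>?n * i - ?n' * j\<bar> < 2 * int K"
    using a[OF assms(2), of Oblong] a[OF assms(2), of Square]
    unfolding abs_less_iff i(2)[symmetric] j(2)[symmetric] by simp
  moreover have "S \<le> g * S" using assms(2) by simp
  then have "4 * int K + 5 \<le> int (g * S)" using S_large by linarith
  ultimately obtain \<sigma> where \<sigma>: "\<bar>\<sigma>\<bar> = 1" "i = 3 * \<sigma>" "j = 2 * \<sigma>"
    using i(1) j(1) assms(2) close_multiples_cases[of i j "int g" "int K" "int (g * S)"]
    by (auto simp: left_size_def algebra_simps)
  show thesis
  proof (rule that[OF \<sigma>(1)])
    show "\<kappa> (Joint g) = \<kappa> (HubPort g s) + \<sigma> * extent g s" for s
      using i(2) j(2) \<sigma>(2,3) by (cases s) (simp_all add: right_size_def algebra_simps)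
  qed
qed

text \<open>\<open>U\<close> is the set of gadgets that point upwards, and \<open>m\<close> the upper of the two middle colors at
  the hub.\<close>

definition direction :: "nat set \<Rightarrow> nat \<Rightarrow> int" where
  "direction U g = (if g \<in> U then 1 else -1)"

definition hub_color :: "int \<Rightarrow> nat set \<Rightarrow> nat \<Rightarrow> part \<Rightarrow> int" where
  "hub_color m U g s = (if g \<in> U \<longleftrightarrow> s = Square then m - int g else m + int g - 1)"

definition joint_color :: "int \<Rightarrow> nat set \<Rightarrow> nat \<Rightarrow> int" where
  "joint_color m U g = (if g \<in> U then m + reach g else m - 1 - reach g)"

definition gadget_range :: "int \<Rightarrow> nat set \<Rightarrow> nat \<Rightarrow> int set" where
  "gadget_range m U g =
    (if g \<in> U then {m - int g..m + reach g} else {m - 1 - reach g..m - 1 + int g})"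

definition aligned :: "(slot \<Rightarrow> int) \<Rightarrow> int \<Rightarrow> nat set \<Rightarrow> bool" where
  "aligned \<kappa> m U \<longleftrightarrow> (\<forall>g\<in>{0<..K}.
    \<kappa> (Joint g) = joint_color m U g \<and> (\<forall>s. \<kappa> (HubPort g s) = hub_color m U g s))"

lemma joint_color_eq:
  "joint_color m U g = hub_color m U g s + direction U g * extent g s"
  unfolding joint_color_def hub_color_def direction_def by (cases s) (simp_all add: extent_eq)

lemma aligned_uminus:
  assumes "aligned \<kappa> m U"
  shows "aligned (\<lambda>x. - \<kappa> x) (1 - m) (- U)"
  using assms by (auto simp: aligned_def hub_color_def joint_color_def)

lemma hub_pair_eq:
  assumes "slot_coloring \<kappa>" "g \<in> {0<..K}"
  shows "\<exists>x. {\<kappa> (HubPort g Oblong), \<kappa> (HubPort g Square)} = {x, x + 2 * int g - 1}"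
proof -
  let ?e = "\<kappa> (HubPort g Oblong)" and ?e' = "\<kappa> (HubPort g Square)"
  obtain \<sigma> where \<sigma>: "\<bar>\<sigma>\<bar> = 1"
    and joint: "\<And>s. \<kappa> (Joint g) = \<kappa> (HubPort g s) + \<sigma> * extent g s"
    using Joint_extreme assms by blast
  have "?e - ?e' = \<sigma> * (2 * int g - 1)"
    using joint[of Oblong] joint[of Square] by (simp add: extent_eq algebra_simps)
  moreover have "\<sigma> = 1 \<or> \<sigma> = -1" using \<sigma> by linarith
  ultimately have "{?e, ?e'} = {min ?e ?e', min ?e ?e' + 2 * int g - 1}"
    using assms(2) by auto
  then show ?thesis by blast
qed

lemma hub_pairs_nested:
  assumes "slot_coloring \<kappa>"
  obtains m where "\<And>g. g \<in> {0<..K} \<Longrightarrow>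
    {\<kappa> (HubPort g Oblong), \<kappa> (HubPort g Square)} = {m - int g, m + int g - 1}"
proof -
  define P where "P g = {\<kappa> (HubPort g Oblong), \<kappa> (HubPort g Square)}" for g
  obtain a where a: "\<And>g s. g \<in> {0<..K} \<Longrightarrow> \<kappa> (HubPort g s) \<in> {a..<a + 2 * int K}"
    using hub_ports_range[OF assms] by auto
  define m where "m = a + int K"
  have "disjoint_family_on P {0<..K}"
    using hub_ports_eq_iff[OF assms] by (auto simp: disjoint_family_on_def P_def)
  moreover have "P g \<subseteq> {m - int K..<m + int K}" if "g \<in> {0<..K}" for g
    using a[OF that, of Oblong] a[OF that, of Square] by (simp add: P_def m_def)
  ultimately have "P g = {m - int g, m + int g - 1}" if "g \<in> {0<..K}" for g
    using hub_pair_eq[OF assms] that unfolding P_def by (intro nested_pairs[of _ K])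
  then show thesis using that unfolding P_def by blast
qed

lemma slot_coloring_imp_aligned:
  assumes "slot_coloring \<kappa>"
  obtains m U where "aligned \<kappa> m U"
proof -
  obtain m where m: "\<And>g. g \<in> {0<..K} \<Longrightarrow>
      {\<kappa> (HubPort g Oblong), \<kappa> (HubPort g Square)} = {m - int g, m + int g - 1}"
    using hub_pairs_nested assms by blast
  define U where "U = {g. \<kappa> (HubPort g Square) < \<kappa> (Joint g)}"
  have "\<kappa> (Joint g) = joint_color m U g \<and> (\<forall>s. \<kappa> (HubPort g s) = hub_color m U g s)"
    if g: "g \<in> {0<..K}" for g
  proof -
    obtain \<sigma> where \<sigma>: "\<bar>\<sigma>\<bar> = 1"
      and joint: "\<And>s. \<kappa> (Joint g) = \<kappa> (HubPort g s) + \<sigma> * extent g s"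
      using Joint_extreme assms g by blast
    have "0 < extent g Square"
      using two_le_p[OF g, of Square] by simp
    then have dir: "\<sigma> = direction U g"
      using \<sigma> joint[of Square] by (auto simp: U_def direction_def abs_if split: if_splits)
    have "\<kappa> (HubPort g s) = hub_color m U g s" for s
      using m[OF g] joint[of Oblong] joint[of Square] g
      by (cases s)
        (auto simp: dir extent_eq direction_def hub_color_def doubleton_eq_iff split: if_splits)
    then show ?thesis using joint[of Square] by (simp add: dir flip: joint_color_eq)
  qed
  then show thesis using that unfolding aligned_def by blast
qed

lemma aligned_gadget_colors:
  assumes "slot_coloring \<kappa>" "aligned \<kappa> m U" "g \<in> {0<..K}"
  shows "\<kappa> ` gadget_slots g = gadget_range m U g"
proof -
  have \<kappa>: "\<kappa> (Joint g) = joint_color m U g" "\<And>s. \<kappa> (HubPort g s) = hub_color m U g s"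
    using assms(2,3) by (auto simp: aligned_def)
  have "int g < reach g" "1 \<le> g" using less_reach assms(3) by auto
  moreover have "\<bar>\<kappa> (Joint g) - \<kappa> (HubPort g s)\<bar> = extent g s" for s
    unfolding \<kappa> joint_color_eq[of m U g s] by (simp add: direction_def)
  ultimately show ?thesis
    using abs_tight_gadget_colors[OF assms(1,3)]
    by (auto simp: \<kappa> hub_color_def joint_color_def gadget_range_def UNIV_part)
qed

subsection \<open>The spectrum\<close>

definition color_count :: "nat \<Rightarrow> int" where
  "color_count i = (if i = 0 then reach K + int K + 1 else reach K + reach i + 2)"

lemma color_count_step: "color_count i + 5 * int S \<le> color_count (Suc i)"
  using S_large by (auto simp: color_count_def reach_def algebra_simps)

lemma aligned_card_colors:
  assumes "slot_coloring \<kappa>" "aligned \<kappa> m U" "K \<in> U"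
  shows "int (card (\<kappa> ` slots)) = color_count (Max (insert 0 ({0<..K} - U)))"
proof -
  let ?up = "\<lambda>g. {m - int g..m + reach g}" and ?down = "\<lambda>g. {m - 1 - reach g..m - 1 + int g}"
  let ?D = "{0<..K} - U"
  have reach: "reach g \<le> reach h" "int g \<le> reach h" if "g \<le> h" for g h
    using monoD[OF mono_reach that] less_reach[of h] that by simp_all
  have "\<kappa> ` slots = (\<Union>g\<in>{0<..K} \<inter> U. ?up g) \<union> (\<Union>g\<in>?D. ?down g)"
    using aligned_gadget_colors[OF assms(1,2)] unfolding slots_def image_UN
    by (auto simp: gadget_range_def split: if_splits)
  also have "(\<Union>g\<in>{0<..K} \<inter> U. ?up g) = ?up K"
    using K_pos assms(3) reach by (intro antisym UN_least UN_upper) auto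
  finally have colors: "\<kappa> ` slots = ?up K \<union> (\<Union>g\<in>?D. ?down g)" .
  show ?thesis
  proof (cases "?D = {}")
    case True
    then show ?thesis using reach[of 0 K] unfolding colors True by (simp add: color_count_def)
  next
    case False
    define b where "b = Max ?D"
    have b: "b \<in> ?D" unfolding b_def using False by (intro Max_in) simp_all
    have max: "g \<le> b" if "g \<in> ?D" for g unfolding b_def using that by (intro Max_ge) simp_all
    have "(\<Union>g\<in>?D. ?down g) = ?down b"
      using b reach max by (intro antisym UN_least UN_upper) auto
    moreover have "int K \<le> reach b"
      using b reach(1)[of 1 b] S_large by (simp add: reach_def)
    ultimately have "\<kappa> ` slots = {m - 1 - reach b..m + reach K}"
      using b reach[of b K] by (auto simp: colors)
    moreover have "Max (insert 0 ?D) = b" using False by (simp add: b_def)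
    ultimately show ?thesis using b reach[of 0 K] reach[of 0 b] by (simp add: color_count_def)
  qed
qed

lemma slot_coloring_card:
  assumes "slot_coloring \<kappa>"
  shows "int (card (\<kappa> ` slots)) \<in> color_count ` {..<K}"
proof -
  have upward: "int (card (\<kappa> ` slots)) \<in> color_count ` {..<K}"
    if "slot_coloring \<kappa>" "aligned \<kappa> m U" "K \<in> U" for \<kappa> m U
  proof -
    have "Max (insert 0 ({0<..K} - U)) < K"
      using that(3) K_pos by (subst Max_less_iff) (auto simp: le_less)
    then show ?thesis using aligned_card_colors[OF that] by blast
  qed
  obtain m U where U: "aligned \<kappa> m U" using slot_coloring_imp_aligned assms by blast
  show ?thesis
  proof (cases "K \<in> U")
    case False
    have "card ((\<lambda>x. - \<kappa> x) ` slots) = card (uminus ` \<kappa> ` slots)" by (simp add: image_image)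
    also have "\<dots> = card (\<kappa> ` slots)" by (intro card_image) simp
    finally show ?thesis
      using upward[OF slot_coloring_uminus[OF assms] aligned_uminus[OF U]] False by simp
  qed (use upward assms U in blast)
qed

fun standard_coloring :: "nat set \<Rightarrow> slot \<Rightarrow> int" where
  "standard_coloring U (HubPort g s) = hub_color 0 U g s"
| "standard_coloring U (Joint g) = joint_color 0 U g"
| "standard_coloring U (Inner g s i j) =
    hub_color 0 U g s + direction U g * (int i + int (wrap (right_size g s) j))"

lemma aligned_standard: "aligned (standard_coloring U) 0 U"
  by (simp add: aligned_def)

lemma hub_colors_consecutive_on: "consecutive_on (\<lambda>(g, s). hub_color m U g s) ({0<..K} \<times> UNIV)"
proof -
  let ?f = "\<lambda>(g, s). hub_color m U g s"
  have "inj_on ?f ({0<..K} \<times> UNIV)"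
    by (auto simp: inj_on_def hub_color_def part_neq_iff split: if_splits)
  moreover have "?f ` ({0<..K} \<times> UNIV) = {m - int K..m + int K - 1}"
  proof (intro equalityI subsetI)
    fix x assume x: "x \<in> {m - int K..m + int K - 1}"
    define g where "g = nat (if x < m then m - x else x - m + 1)"
    have "g \<in> {0<..K}" using x by (auto simp: g_def)
    moreover have "x = ?f (g, if g \<in> U \<longleftrightarrow> x < m then Square else Oblong)"
      by (auto simp: hub_color_def g_def)
    ultimately show "x \<in> ?f ` ({0<..K} \<times> UNIV)" by blast
  qed (auto simp: hub_color_def split: if_splits)
  ultimately show ?thesis by (auto simp: consecutive_on_def consecutive_def)
qed

lemma slot_coloring_standard: "slot_coloring (standard_coloring U)"
  unfolding slot_coloring_def
proof (intro conjI ballI allI)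
  show "consecutive_on (\<lambda>(g, s). standard_coloring U (HubPort g s)) ({0<..K} \<times> UNIV)"
    unfolding standard_coloring.simps by (rule hub_colors_consecutive_on)
next
  fix g s assume g: "g \<in> {0<..K}"
  let ?p = "left_size g s" and ?q = "right_size g s"
  let ?R = "\<lambda>i j. if i = 0 \<and> j = 0 then 0 else int i + int (wrap ?q j)"
  let ?C = "\<lambda>i j. if i = 0 \<and> j = 0 then int ?p + int ?q else int i + int (wrap ?q j)"
  let ?shift = "\<lambda>x. hub_color 0 U g s + direction U g * x"
  have "ported_grid ?p ?q (\<lambda>i j. ?shift (?R i j)) (\<lambda>i j. ?shift (?C i j))"
    using ported_grid_ascending[OF two_le_p[OF g] two_le_q[OF g]]
    by (rule ported_grid.ported_grid_affine) (simp add: direction_def)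
  moreover have "standard_coloring U (row_slot g s i j) = ?shift (?R i j)"
    "standard_coloring U (col_slot g s i j) = ?shift (?C i j)" for i j
    by (simp_all add: row_slot_def col_slot_def joint_color_eq[of 0 U g s])
  ultimately show "ported_grid ?p ?q (row_colors (standard_coloring U) g s)
      (col_colors (standard_coloring U) g s)" by simp
qed

lemma interval_spectrum_eq: "interval_spectrum verts edges = color_count ` {..K - 1}"
proof -
  have "color_count i \<in> {int (card (\<kappa> ` slots)) |\<kappa>. slot_coloring \<kappa>}" if "i < K" for i
  proof -
    have "insert 0 ({0<..K} - - {i}) = {0, i}" using that by auto
    then have "int (card (standard_coloring (- {i}) ` slots)) = color_count i"
      using aligned_card_colors[OF slot_coloring_standard aligned_standard, of "- {i}"] that
      by simp
    then show ?thesis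
      using slot_coloring_standard by (intro CollectI exI[of _ "standard_coloring (- {i})"]) simp
  qed
  then have "interval_spectrum verts edges = color_count ` {..<K}"
    using slot_coloring_card unfolding interval_spectrum_verts by blast
  moreover have "{..<K} = {..K - 1}" using K_pos by auto
  ultimately show ?thesis by simp
qed

lemma color_count_sparse: "color_count i + 1 < color_count (Suc i)"
  using color_count_step[of i] S_large by simp

lemma gaps_interval_spectrum:
  "gaps (interval_spectrum verts edges) =
    (\<lambda>i. {color_count i<..<color_count (Suc i)}) ` {..<K - 1}"
  unfolding interval_spectrum_eq by (rule gaps_sparse[of color_count, OF color_count_sparse])

lemma card_gaps_interval_spectrum: "card (gaps (interval_spectrum verts edges)) = K - 1"
  unfolding interval_spectrum_eq by (rule card_gaps_sparse[of color_count, OF color_count_sparse])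

lemma gap_size_ge:
  assumes "X \<in> gaps (interval_spectrum verts edges)"
  shows "S \<le> card X"
proof -
  obtain i where "X = {color_count i<..<color_count (Suc i)}"
    using assms unfolding gaps_interval_spectrum by blast
  then show ?thesis using color_count_step[of i] S_large by simp
qed

end

theorem theorem3:
  fixes k d :: nat
  shows "\<exists>(V :: nat set) E. fin_graph V E \<and>
           finite (gaps (interval_spectrum V E)) \<and>
           card (gaps (interval_spectrum V E)) = k \<and>
           (\<forall>X \<in> gaps (interval_spectrum V E). d \<le> card X)"
proof -
  define S where "S = 4 * Suc k + 5 + d"
  interpret gadget_family "Suc k" S by unfold_locales (auto simp: S_def)
  let ?V = "to_nat ` verts" and ?E = "(`) to_nat ` edges"
  have "fin_graph ?V ?E"
    by (rule fin_graph_image[OF inj_to_nat fin_graph_verts])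
  moreover have "interval_spectrum ?V ?E = interval_spectrum verts edges"
    by (rule interval_spectrum_image[OF finite_edges[OF fin_graph_verts] inj_to_nat])
  moreover have "finite (gaps (interval_spectrum verts edges))"
    by (simp add: gaps_interval_spectrum)
  moreover have "card (gaps (interval_spectrum verts edges)) = k"
    by (simp add: card_gaps_interval_spectrum)
  moreover have "d \<le> card X" if "X \<in> gaps (interval_spectrum verts edges)" for X
    using gap_size_ge[OF that] by (simp add: S_def)
  ultimately show ?thesis by (intro exI[of _ ?V] exI[of _ ?E]) simp
qed

end
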